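(* Let $p=(12,R)$ be the mesh pattern with $R=\{(0,0),(0,1),(1,2),(2,0),(2,1)\}$. Let $F(x)=\sum_{n\ge0}n!\,x^n$, $F(x,q)=\sum_{n\ge 0}x^n\sum_{\pi\in S_n}q^{p(\pi)}$, and $A(x)=\sum_{n\ge0}|S_n(p)|x^n$. Then, as formal power series in $x$, $$A(x) = \frac{2F(x)-1}{F(x)},\qquad F(x,q) = \frac{(2-q)F(x)+q-1}{(1-q)F(x)+q}.$$
   Context: $S_n$ is the set of permutations $\pi=\pi_1\cdots\pi_n$ of $\{1,\dots,n\}$ ($S_0$ contains only the empty permutation). A mesh pattern $(12,R)$ consists of the permutation $12$ and a set $R\subseteq\{0,1,2\}\times\{0,1,2\}$ of shaded boxes. An occurrence of $(12,R)$ in $\pi\in S_n$ is a pair of positions $s<t$ with $\pi_s<\pi_t$ such that, putting $s_0=0,\ s_1=s,\ s_2=t,\ s_3=n+1$ and $v_0=0,\ v_1=\pi_s,\ v_2=\pi_t,\ v_3=n+1$, for every $(i,j)\in R$ there is no position $m$ with $s_i<m<s_{i+1}$ and $v_j<\pi_m<v_{j+1}$. $p(\pi)$ is the number of occurrences of $p$ in $\pi$, and $S_n(p)$ is the set of $\pi\in S_n$ with $p(\pi)=0$ (permutations avoiding $p$). *)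

theory Defs
  imports
    "HOL-Combinatorics.Permutations"
    "HOL-Computational_Algebra.Formal_Power_Series"
    "HOL-Computational_Algebra.Polynomial"
    "HOL-Computational_Algebra.Fraction_Field"
begin

definition perms :: "nat \<Rightarrow> (nat \<Rightarrow> nat) set" where
  "perms n = {\<pi>. \<pi> permutes {1..n}}"

text \<open>The grid lines 0, a, b, n + 1 (indexed 0, 1, 2, 3) that cut the positions into the
  columns of boxes, respectively the values into the rows.\<close>

definition grid_line :: "nat \<Rightarrow> nat \<Rightarrow> nat \<Rightarrow> nat \<Rightarrow> nat" where
  "grid_line n a b i = [0, a, b, n + 1] ! i"

text \<open>The set of occurrences of the mesh pattern (12, R), where R is a subset of
  {0,1,2} x {0,1,2}; the first coordinate of a box refers to positions, the second to values.\<close>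

definition mesh12_occurrences :: "(nat \<times> nat) set \<Rightarrow> nat \<Rightarrow> (nat \<Rightarrow> nat) \<Rightarrow> (nat \<times> nat) set" where
  "mesh12_occurrences R n \<pi> =
    {(s, t). s \<in> {1..n} \<and> t \<in> {1..n} \<and> s < t \<and> \<pi> s < \<pi> t \<and>
      (\<forall>(i, j) \<in> R. \<not> (\<exists>m \<in> {1..n}.
         grid_line n s t i < m \<and> m < grid_line n s t (i + 1) \<and>
         grid_line n (\<pi> s) (\<pi> t) j < \<pi> m \<and> \<pi> m < grid_line n (\<pi> s) (\<pi> t) (j + 1)))}"

definition mesh12_count :: "(nat \<times> nat) set \<Rightarrow> nat \<Rightarrow> (nat \<Rightarrow> nat) \<Rightarrow> nat" where
  "mesh12_count R n \<pi> = card (mesh12_occurrences R n \<pi>)"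

definition mesh12_avoiders :: "(nat \<times> nat) set \<Rightarrow> nat \<Rightarrow> (nat \<Rightarrow> nat) set" where
  "mesh12_avoiders R n = {\<pi> \<in> perms n. mesh12_count R n \<pi> = 0}"

definition fact_fps :: "'a::comm_ring_1 fps" where
  "fact_fps = Abs_fps (\<lambda>n. of_nat (fact n))"

definition avoidance_fps :: "(nat \<times> nat) set \<Rightarrow> 'a::comm_ring_1 fps" where
  "avoidance_fps R = Abs_fps (\<lambda>n. of_nat (card (mesh12_avoiders R n)))"

definition distribution_fps :: "(nat \<times> nat) set \<Rightarrow> 'a::comm_ring_1 \<Rightarrow> 'a fps" where
  "distribution_fps R q = Abs_fps (\<lambda>n. \<Sum>\<pi> \<in> perms n. q ^ mesh12_count R n \<pi>)"

text \<open>The indeterminate q, taken in the field of fractions of the polynomial ring over the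
  integers, so that power series in x over this field can be divided.\<close>

definition qvar :: "int poly fract" where
  "qvar = Fract [:0, 1:] 1"

end

theory Submission
  imports Defs
begin

text \<open>
  In an occurrence \<open>(s, t)\<close> of the pattern, with top value \<open>b = \<pi> t\<close>, the four boxes in the outer
  columns force every value below \<open>b\<close> into the positions from \<open>s\<close> to \<open>t\<close>, and the box (1,2) keeps
  every value above \<open>b\<close> out of them. So these positions hold exactly the values \<open>1, ..., b\<close>, with \<open>b\<close>
  in the last place. Conversely each such block with \<open>b \<ge> 2\<close> is an occurrence, and \<open>b\<close> determines
  it: counting occurrences means counting the possible tops \<open>b\<close> (\<open>mesh12_count_eq_card_block_tops\<close>).

  The blocks of one permutation are nested. Fix a top \<open>b\<close> in \<open>S\<^sub>n\<close>. The first \<open>b - 1\<close> entries of its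
  block form an arbitrary permutation \<open>\<sigma>\<close> of \<open>S\<^sub>b\<^sub>-\<^sub>1\<close>, and the tops below \<open>b\<close> are precisely the tops
  of \<open>\<sigma>\<close>. The \<open>n - b\<close> larger values fill the other places freely, and the block can start in
  \<open>n - b + 1\<close> places, so \<open>(n - b + 1)!\<close> permutations share the same \<open>b\<close> and \<open>\<sigma>\<close>.

  To turn this into a recurrence, write \<open>q ^ card S\<close> as 1 plus \<open>q - 1\<close> times the sum, over \<open>b\<close> in \<open>S\<close>, of
  \<open>q\<close> to the number of elements of \<open>S\<close> below \<open>b\<close>. Summing over \<open>S\<^sub>n\<close> with \<open>S\<close> the set of tops gives
  (\<open>block_poly_rec\<close>) that the distribution polynomials \<open>w\<^sub>n\<close> satisfy
  \<open>w\<^sub>n = n! + (q - 1) (\<Sum>b=2..n. w\<^sub>b\<^sub>-\<^sub>1 (n - b + 1)!)\<close>. For \<open>W = \<Sum>n. w\<^sub>n x\<^sup>n\<close> and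
  \<open>F = \<Sum>n. n! x\<^sup>n\<close> this is the equation \<open>W - 1 = (F - 1) + (q - 1) (W - 1) (F - 1)\<close>, which is linear in
  \<open>W\<close>. Avoidance is the value at \<open>q = 0\<close>.
\<close>

section \<open>Occurrences as blocks of smallest values\<close>

text \<open>Blocks are located by the number \<open>s\<close> of positions to their left rather than by their first
  position, so that moving a block is adding to \<open>s\<close>.\<close>

definition prefix_block :: "(nat \<Rightarrow> nat) \<Rightarrow> nat \<Rightarrow> nat \<Rightarrow> bool" where
  "prefix_block \<pi> s b \<longleftrightarrow> \<pi> ` {s+1..s+b} = {1..b} \<and> \<pi> (s + b) = b"

text \<open>The value 1 alone is always a block, but not an occurrence of a pattern of length two; hence
  tops start at 2.\<close>

definition block_tops :: "nat \<Rightarrow> (nat \<Rightarrow> nat) \<Rightarrow> nat set" where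
  "block_tops n \<pi> = {b \<in> {2..n}. \<exists>s. s + b \<le> n \<and> prefix_block \<pi> s b}"

lemma finite_block_tops [simp]: "finite (block_tops n \<pi>)"
  by (simp add: block_tops_def)

lemma finite_perms [simp]: "finite (perms n)"
  by (simp add: perms_def finite_permutations)

lemma card_perms: "card (perms n) = fact n"
  by (simp add: perms_def card_permutations)

text \<open>The first entry of the occurrence may be any value below the top, since the unshaded boxes (1,0)
  and (1,1) leave the order inside the block free. This is why the right-hand side puts no
  condition on \<open>\<pi> s\<close>.\<close>

lemma mesh12_occurrences_iff:
  assumes "\<pi> \<in> perms n"
  shows "(s, t) \<in> mesh12_occurrences {(0, 0), (0, 1), (1, 2), (2, 0), (2, 1)} n \<pi> \<longleftrightarrow>
    1 \<le> s \<and> s < t \<and> t \<le> n \<and> \<pi> ` {s..t} = {1..\<pi> t}"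
proof -
  have perm: "\<pi> permutes {1..n}" using assms by (simp add: perms_def)
  have inj: "\<pi> x = \<pi> y \<longleftrightarrow> x = y" for x y
    using inj_eq[OF permutes_inj[OF perm]] .
  have range: "1 \<le> \<pi> m \<and> \<pi> m \<le> n" if "1 \<le> m" "m \<le> n" for m
    using permutes_in_image[OF perm, of m] that by auto
  have boxes: "(s, t) \<in> mesh12_occurrences {(0, 0), (0, 1), (1, 2), (2, 0), (2, 1)} n \<pi> \<longleftrightarrow>
    s \<in> {1..n} \<and> t \<in> {1..n} \<and> s < t \<and> \<pi> s < \<pi> t \<and>
    (\<forall>m\<in>{1..n}. \<not> (0 < m \<and> m < s \<and> 0 < \<pi> m \<and> \<pi> m < \<pi> s) \<and>
      \<not> (0 < m \<and> m < s \<and> \<pi> s < \<pi> m \<and> \<pi> m < \<pi> t) \<and>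
      \<not> (s < m \<and> m < t \<and> \<pi> t < \<pi> m \<and> \<pi> m < n + 1) \<and>
      \<not> (t < m \<and> m < n + 1 \<and> 0 < \<pi> m \<and> \<pi> m < \<pi> s) \<and>
      \<not> (t < m \<and> m < n + 1 \<and> \<pi> s < \<pi> m \<and> \<pi> m < \<pi> t))"
    unfolding mesh12_occurrences_def grid_line_def
    by (simp add: numeral_2_eq_2 numeral_3_eq_3 ball_conj_distrib del: atLeastAtMost_iff)
      (intro conj_cong ball_cong refl; auto)
  show ?thesis
  proof
    assume occ: "(s, t) \<in> mesh12_occurrences {(0, 0), (0, 1), (1, 2), (2, 0), (2, 1)} n \<pi>"
    then have st: "1 \<le> s" "s < t" "t \<le> n" "\<pi> s < \<pi> t"
      unfolding boxes by simp_all
    have outside: "\<not> \<pi> m < \<pi> t" if "m < s \<or> t < m" "1 \<le> m" "m \<le> n" for m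
    proof -
      have "\<pi> m \<noteq> \<pi> s" "m \<in> {1..n}" using inj that st by auto
      then show ?thesis
        using occ that range[OF that(2,3)] unfolding boxes
        by (metis Suc_eq_plus1 less_Suc_eq_le linorder_neqE_nat less_le_trans zero_less_one)
    qed
    have inside: "\<pi> m \<le> \<pi> t" if "s < m" "m < t" for m
    proof -
      have "m \<in> {1..n}" "\<pi> m < n + 1" using that st range[of m] by auto
      then show ?thesis using occ that unfolding boxes by (meson not_le)
    qed
    have "\<pi> ` {s..t} = {1..\<pi> t}"
    proof (intro equalityI subsetI)
      fix v assume "v \<in> \<pi> ` {s..t}"
      then obtain m where m: "v = \<pi> m" "s \<le> m" "m \<le> t" by auto
      then have "\<pi> m \<le> \<pi> t" using inside[of m] st by (cases "m = s \<or> m = t") auto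
      then show "v \<in> {1..\<pi> t}" using m range[of m] st by auto
    next
      fix v assume v: "v \<in> {1..\<pi> t}"
      then have "v \<in> {1..n}" using range[of t] st by auto
      then obtain m where m: "v = \<pi> m" "m \<in> {1..n}"
        using permutes_image[OF perm] by blast
      have "s \<le> m \<and> m \<le> t"
      proof (rule ccontr)
        assume "\<not> (s \<le> m \<and> m \<le> t)"
        then have "\<not> \<pi> m < \<pi> t" "m \<noteq> t" using outside[of m] m st by auto
        then show False using v m inj[of m t] by auto
      qed
      then show "v \<in> \<pi> ` {s..t}" using m by auto
    qed
    then show "1 \<le> s \<and> s < t \<and> t \<le> n \<and> \<pi> ` {s..t} = {1..\<pi> t}" using st by blast
  next
    assume *: "1 \<le> s \<and> s < t \<and> t \<le> n \<and> \<pi> ` {s..t} = {1..\<pi> t}"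
    have inside: "\<pi> m \<le> \<pi> t" if "s \<le> m" "m \<le> t" for m
    proof -
      have "\<pi> m \<in> \<pi> ` {s..t}" using that by auto
      then show ?thesis using * by auto
    qed
    have outside: "\<pi> t < \<pi> m" if "m < s \<or> t < m" "1 \<le> m" "m \<le> n" for m
    proof (rule ccontr)
      assume "\<not> \<pi> t < \<pi> m"
      then have "\<pi> m \<in> \<pi> ` {s..t}" using * range[of m] that by auto
      then show False using inj that by auto
    qed
    have "\<pi> s < \<pi> t" using inside[of s] inj[of s t] * by linarith
    then show "(s, t) \<in> mesh12_occurrences {(0, 0), (0, 1), (1, 2), (2, 0), (2, 1)} n \<pi>"
      unfolding boxes
    proof (intro conjI ballI)
      fix m assume "m \<in> {1..n}"
      note m = this inside[of m] outside[of m] \<open>\<pi> s < \<pi> t\<close>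
      show "\<not> (0 < m \<and> m < s \<and> 0 < \<pi> m \<and> \<pi> m < \<pi> s)"
        "\<not> (0 < m \<and> m < s \<and> \<pi> s < \<pi> m \<and> \<pi> m < \<pi> t)"
        "\<not> (s < m \<and> m < t \<and> \<pi> t < \<pi> m \<and> \<pi> m < n + 1)"
        "\<not> (t < m \<and> m < n + 1 \<and> 0 < \<pi> m \<and> \<pi> m < \<pi> s)"
        "\<not> (t < m \<and> m < n + 1 \<and> \<pi> s < \<pi> m \<and> \<pi> m < \<pi> t)"
        using m by auto
    qed (use * in auto)
  qed
qed

text \<open>The top value \<open>\<pi> t\<close> determines \<open>t\<close> by injectivity, and then \<open>s\<close>, because the block has \<open>\<pi> t\<close>
  entries.\<close>

lemma mesh12_count_eq_card_block_tops:
  assumes "\<pi> \<in> perms n"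
  shows "mesh12_count {(0, 0), (0, 1), (1, 2), (2, 0), (2, 1)} n \<pi> = card (block_tops n \<pi>)"
proof -
  let ?R = "{(0, 0), (0, 1), (1, 2), (2, 0), (2, 1)} :: (nat \<times> nat) set"
  have perm: "\<pi> permutes {1..n}" using assms by (simp add: perms_def)
  note inj = permutes_inj[OF perm]
  have length: "t + 1 - s = \<pi> t" if "\<pi> ` {s..t} = {1..\<pi> t}" for s t
    using card_image[OF inj_on_subset[OF inj], of "{s..t}"] that by simp
  have "bij_betw (\<lambda>(s, t). \<pi> t) (mesh12_occurrences ?R n \<pi>) (block_tops n \<pi>)"
    unfolding bij_betw_def
  proof (intro conjI equalityI subsetI)
    show "inj_on (\<lambda>(s, t). \<pi> t) (mesh12_occurrences ?R n \<pi>)"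
    proof (rule inj_onI, clarify)
      fix s t s' t'
      assume occs: "(s, t) \<in> mesh12_occurrences ?R n \<pi>" "(s', t') \<in> mesh12_occurrences ?R n \<pi>"
        and eq: "\<pi> t = \<pi> t'"
      have "t = t'" using inj eq by (rule injD)
      then show "s = s' \<and> t = t'"
        using occs length[of s t] length[of s' t'] unfolding mesh12_occurrences_iff[OF assms] by auto
    qed
  next
    fix b assume "b \<in> (\<lambda>(s, t). \<pi> t) ` mesh12_occurrences ?R n \<pi>"
    then obtain s t where "(s, t) \<in> mesh12_occurrences ?R n \<pi>" and b: "b = \<pi> t"
      by auto
    then have st: "1 \<le> s" "s < t" "t \<le> n" "\<pi> ` {s..t} = {1..\<pi> t}"
      unfolding mesh12_occurrences_iff[OF assms] by auto
    then have *: "t = s - 1 + b" "s = s - 1 + 1" "2 \<le> b" using length[of s t] b by linarith+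
    then have "prefix_block \<pi> (s - 1) b" using st b unfolding prefix_block_def by metis
    then show "b \<in> block_tops n \<pi>"
      unfolding block_tops_def using * st by (auto intro!: exI[of _ "s - 1"])
  next
    fix b assume "b \<in> block_tops n \<pi>"
    then obtain s where "2 \<le> b" "s + b \<le> n" "prefix_block \<pi> s b"
      by (auto simp: block_tops_def)
    then have "(s + 1, s + b) \<in> mesh12_occurrences ?R n \<pi>" "b = \<pi> (s + b)"
      unfolding mesh12_occurrences_iff[OF assms] by (auto simp: prefix_block_def)
    then show "b \<in> (\<lambda>(s, t). \<pi> t) ` mesh12_occurrences ?R n \<pi>" by force
  qed
  then show ?thesis unfolding mesh12_count_def by (rule bij_betw_same_card)
qed

section \<open>Permutations with a prescribed block\<close>

lemma prefix_block_shift: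
  assumes "\<And>i. i \<in> {1..b} \<Longrightarrow> \<pi> (s + i) = \<sigma> i" and "1 \<le> c" and "u + c \<le> b"
  shows "prefix_block \<pi> (s + u) c \<longleftrightarrow> prefix_block \<sigma> u c"
proof -
  have "\<pi> ` {s+u+1..s+u+c} = \<sigma> ` {u+1..u+c}"
  proof -
    have "{s+u+1..s+u+c} = (\<lambda>i. s + i) ` {u+1..u+c}"
      by (simp add: image_add_atLeastAtMost add.assoc)
    also have "\<pi> ` \<dots> = \<sigma> ` {u+1..u+c}"
      unfolding image_image using assms by (intro image_cong) auto
    finally show ?thesis .
  qed
  moreover have "\<pi> (s + u + c) = \<sigma> (u + c)"
    using assms(1)[of "u + c"] assms by (simp add: add.assoc)
  ultimately show ?thesis by (simp add: prefix_block_def)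
qed

text \<open>A block with a smaller top consists of smaller values, all of which lie inside the block of \<open>b\<close>;
  it cannot use the last place, which holds \<open>b\<close> itself. So it is already a block of the pattern \<open>\<sigma>\<close>
  of the remaining \<open>b - 1\<close> entries.\<close>

lemma block_tops_below:
  assumes inj: "inj \<pi>" and "1 \<le> b" "s + b \<le> n" and block: "prefix_block \<pi> s b"
    and agree: "\<And>i. i \<in> {1..b-1} \<Longrightarrow> \<pi> (s + i) = \<sigma> i"
  shows "block_tops n \<pi> \<inter> {..<b} = block_tops (b - 1) \<sigma>"
proof (intro equalityI subsetI)
  fix c assume "c \<in> block_tops n \<pi> \<inter> {..<b}"
  then obtain u where u: "2 \<le> c" "c < b" "u + c \<le> n" "prefix_block \<pi> u c"
    by (auto simp: block_tops_def)
  have sub: "\<pi> ` {u+1..u+c} \<subseteq> \<pi> ` {s+1..s+b}"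
    using u block by (auto simp: prefix_block_def)
  have "{u+1..u+c} \<subseteq> {s+1..s+b}" using sub inj by (simp add: inj_image_subset_iff)
  then have "s \<le> u" "u + c \<le> s + b" using u by auto
  moreover have "u + c \<noteq> s + b" using u block by (auto simp: prefix_block_def)
  ultimately have us: "u = s + (u - s)" "u - s + c \<le> b - 1" using \<open>c < b\<close> by auto
  have "prefix_block \<sigma> (u - s) c"
    using prefix_block_shift[of "b - 1" \<pi> s \<sigma> c "u - s"] agree u us by auto
  then show "c \<in> block_tops (b - 1) \<sigma>"
    using u us(2) by (auto simp: block_tops_def intro!: exI[of _ "u - s"])
next
  fix c assume "c \<in> block_tops (b - 1) \<sigma>"
  then obtain u where u: "2 \<le> c" "c \<le> b - 1" "u + c \<le> b - 1" "prefix_block \<sigma> u c"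
    by (auto simp: block_tops_def)
  then have "prefix_block \<pi> (s + u) c"
    using prefix_block_shift[of "b - 1" \<pi> s \<sigma> c u] agree by auto
  then show "c \<in> block_tops n \<pi> \<inter> {..<b}"
    using u assms by (auto simp: block_tops_def intro!: exI[of _ "s + u"])
qed

lemma bij_betw_permutes_disjoint_union:
  assumes "A \<inter> B = {}" and "finite A" "finite B"
  shows "bij_betw (\<lambda>(\<sigma>, \<rho>). \<sigma> \<circ> \<rho>) ({\<sigma>. \<sigma> permutes A} \<times> {\<rho>. \<rho> permutes B})
    {g. g permutes A \<union> B \<and> g ` A = A}"
proof (rule bij_betw_byWitness[where f' = "\<lambda>g. (restrict_id g A, restrict_id g B)"])
  let ?P = "{\<sigma>. \<sigma> permutes A} \<times> {\<rho>. \<rho> permutes B}"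
  have fixA: "\<rho> x = x" if "\<rho> permutes B" "x \<in> A" for \<rho> x
    using that assms permutes_not_in[of \<rho> B x] by auto
  have fixB: "\<sigma> (\<rho> x) = \<rho> x" if "\<sigma> permutes A" "\<rho> permutes B" "x \<in> B" for \<sigma> \<rho> x
    using that assms permutes_not_in[of \<sigma> A "\<rho> x"] permutes_in_image[of \<rho> B x] by auto
  show "\<forall>x\<in>?P. (\<lambda>g. (restrict_id g A, restrict_id g B)) ((\<lambda>(\<sigma>, \<rho>). \<sigma> \<circ> \<rho>) x) = x"
    by (auto simp: fun_eq_iff restrict_id_def fixA fixB permutes_not_in)
  show "(\<lambda>(\<sigma>, \<rho>). \<sigma> \<circ> \<rho>) ` ?P \<subseteq> {g. g permutes A \<union> B \<and> g ` A = A}"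
  proof clarify
    fix \<sigma> \<rho> assume *: "\<sigma> permutes A" "\<rho> permutes B"
    have "(\<sigma> \<circ> \<rho>) ` A = \<sigma> ` A" using * by (auto simp: fixA image_def)
    then show "\<sigma> \<circ> \<rho> permutes A \<union> B \<and> (\<sigma> \<circ> \<rho>) ` A = A"
      using * by (auto intro!: permutes_compose permutes_subset[of \<sigma> A] permutes_subset[of \<rho> B]
          simp: permutes_image)
  qed
  have B: "g ` B = B" if "g permutes A \<union> B" "g ` A = A" for g
  proof -
    have "B = (A \<union> B) - A" using assms by auto
    then have "g ` B = g ` (A \<union> B) - g ` A"
      using image_set_diff[OF permutes_inj[OF that(1)]] by metis
    then show ?thesis using that permutes_image[OF that(1)] assms by auto
  qed
  have restrict: "restrict_id g C permutes C" if "g permutes A \<union> B" "g ` C = C" for g C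
    using that permutes_inj[OF that(1)] 
    by (intro permutes_restrict_id) (auto simp: bij_betw_def intro: inj_on_subset)
  show "(\<lambda>g. (restrict_id g A, restrict_id g B)) ` {g. g permutes A \<union> B \<and> g ` A = A} \<subseteq> ?P"
    using B restrict by auto
  show "\<forall>g\<in>{g. g permutes A \<union> B \<and> g ` A = A}.
      (\<lambda>(\<sigma>, \<rho>). \<sigma> \<circ> \<rho>) (restrict_id g A, restrict_id g B) = g"
  proof clarify
    fix g assume g: "g permutes A \<union> B" "g ` A = A"
    have "(restrict_id g A \<circ> restrict_id g B) x = g x" for x
      using assms B[OF g] g permutes_not_in[OF g(1), of x]
      by (auto simp: restrict_id_def)
    then show "restrict_id g A \<circ> restrict_id g B = g" by blast
  qed
qed

text \<open>The permutation of positions that moves the block behind the first \<open>s\<close> positions to the very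
  front. Composing with it reduces prescribing a block at \<open>s\<close> to prescribing the image of an initial
  segment. The position 0 is fixed because permutations act on \<open>{1..n}\<close>.\<close>

definition block_to_front :: "nat \<Rightarrow> nat \<Rightarrow> nat \<Rightarrow> nat" where
  "block_to_front s b i =
    (if i = 0 \<or> s + b < i then i else if i \<le> s then i + b else i - s)"

lemma block_to_front_permutes:
  assumes "s + b \<le> n"
  shows "block_to_front s b permutes {1..n}"
proof (rule inj_imp_permutes)
  show "inj_on (block_to_front s b) {1..n}"
    by (auto simp: inj_on_def block_to_front_def split: if_splits)
qed (use assms in \<open>auto simp: block_to_front_def\<close>)

text \<open>With the block moved to the front, the permutation fixes \<open>b\<close> and preserves the values below
  \<open>b\<close>, hence also those above \<open>b\<close>; its two parts are independent.\<close>

lemma bij_betw_prefix_block_perms: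
  assumes "1 \<le> b" "s + b \<le> n"
  shows "bij_betw (\<lambda>(\<sigma>, \<rho>). \<sigma> \<circ> \<rho> \<circ> block_to_front s b)
    (perms (b - 1) \<times> {\<rho>. \<rho> permutes {b+1..n}}) {\<pi> \<in> perms n. prefix_block \<pi> s b}"
proof -
  define c where "c = block_to_front s b"
  have c: "c permutes {1..n}" using block_to_front_permutes assms by (simp add: c_def)
  have c_block: "c (s + i) = i" if "i \<in> {1..b}" for i
    using that by (auto simp: c_def block_to_front_def)
  let ?A = "{1..b-1}" and ?B = "{b+1..n}"
  let ?G = "{g. g permutes ?A \<union> ?B \<and> g ` ?A = ?A}"
  have A: "{1..b} = insert b ?A" using assms by auto
  have block: "prefix_block (g \<circ> c) s b \<longleftrightarrow> g ` ?A = ?A \<and> g b = b" if "inj g" for g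
  proof -
    have "{s+1..s+b} = (\<lambda>i. s + i) ` {1..b}"
      by (simp add: image_add_atLeastAtMost)
    then have "(g \<circ> c) ` {s+1..s+b} = g ` (\<lambda>i. c (s + i)) ` {1..b}"
      by (simp only: image_comp comp_def)
    also have "(\<lambda>i. c (s + i)) ` {1..b} = {1..b}" using c_block by (simp add: image_def)
    finally have img: "(g \<circ> c) ` {s+1..s+b} = g ` {1..b}" .
    have top: "(g \<circ> c) (s + b) = g b" using c_block[of b] assms by auto
    have "g ` {1..b} = {1..b} \<longleftrightarrow> g ` ?A = ?A" if gb: "g b = b"
    proof -
      have "b \<notin> ?A" using assms by auto
      moreover have "b \<notin> g ` ?A" 
        using gb \<open>inj g\<close> \<open>b \<notin> ?A\<close> by (metis inj_image_mem_iff)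
      ultimately show ?thesis unfolding A image_insert gb by (simp add: insert_ident)
    qed
    then show ?thesis unfolding prefix_block_def img top by blast
  qed
  have "bij_betw (\<lambda>g. g \<circ> c) ?G {\<pi> \<in> perms n. prefix_block \<pi> s b}"
  proof (rule bij_betw_byWitness[where f' = "\<lambda>\<pi>. \<pi> \<circ> inv c"])
    have invs: "c \<circ> inv c = id" "inv c \<circ> c = id"
      using permutes_inv_o[OF c] by auto
    show "\<forall>g\<in>?G. g \<circ> c \<circ> inv c = g" "\<forall>\<pi>\<in>{\<pi> \<in> perms n. prefix_block \<pi> s b}. \<pi> \<circ> inv c \<circ> c = \<pi>"
      by (simp_all add: comp_assoc invs)
    show "(\<lambda>g. g \<circ> c) ` ?G \<subseteq> {\<pi> \<in> perms n. prefix_block \<pi> s b}"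
    proof clarify
      fix g assume g: "g permutes ?A \<union> ?B" "g ` ?A = ?A"
      have "?A \<union> ?B \<subseteq> {1..n}" using assms by auto
      then have "g permutes {1..n}" using g permutes_subset by blast
      moreover have "g b = b" using g assms by (intro permutes_not_in[OF g(1)]) auto
      ultimately show "g \<circ> c \<in> perms n \<and> prefix_block (g \<circ> c) s b"
        using g block[OF permutes_inj] permutes_compose[OF c] by (auto simp: perms_def)
    qed
    show "(\<lambda>\<pi>. \<pi> \<circ> inv c) ` {\<pi> \<in> perms n. prefix_block \<pi> s b} \<subseteq> ?G"
    proof clarify
      fix \<pi> assume \<pi>: "\<pi> \<in> perms n" "prefix_block \<pi> s b"
      define g where "g = \<pi> \<circ> inv c"
      have g: "g permutes {1..n}"
        using \<pi> permutes_compose[OF permutes_inv[OF c]] by (auto simp: perms_def g_def)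
      have "\<pi> = g \<circ> c" by (simp add: g_def comp_assoc invs)
      then have "g ` ?A = ?A" "g b = b" using \<pi> block[OF permutes_inj[OF g]] by auto
      moreover have "g permutes ?A \<union> ?B"
        using g
      proof (rule permutes_superset)
        fix x assume "x \<in> {1..n} - (?A \<union> ?B)"
        then have "x = b" by auto
        then show "g x = x" using \<open>g b = b\<close> by simp
      qed
      ultimately show "\<pi> \<circ> inv c permutes ?A \<union> ?B \<and> (\<pi> \<circ> inv c) ` ?A = ?A"
        unfolding g_def by blast
    qed
  qed
  moreover have "bij_betw (\<lambda>(\<sigma>, \<rho>). \<sigma> \<circ> \<rho>) (perms (b - 1) \<times> {\<rho>. \<rho> permutes ?B}) ?G"
    unfolding perms_def using assms by (intro bij_betw_permutes_disjoint_union) auto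
  ultimately have "bij_betw ((\<lambda>g. g \<circ> c) \<circ> (\<lambda>(\<sigma>, \<rho>). \<sigma> \<circ> \<rho>))
      (perms (b - 1) \<times> {\<rho>. \<rho> permutes ?B}) {\<pi> \<in> perms n. prefix_block \<pi> s b}"
    by (rule bij_betw_trans[rotated])
  then show ?thesis by (simp add: c_def comp_def case_prod_unfold)
qed

section \<open>The recurrence for the block distribution\<close>

definition block_poly :: "'a::comm_ring_1 \<Rightarrow> nat \<Rightarrow> 'a" where
  "block_poly q n = (\<Sum>\<pi>\<in>perms n. q ^ card (block_tops n \<pi>))"

lemma sum_fixed_block:
  fixes q :: "'a::comm_ring_1"
  assumes "1 \<le> b" "s + b \<le> n"
  shows "(\<Sum>\<pi> | \<pi> \<in> perms n \<and> prefix_block \<pi> s b. q ^ card (block_tops n \<pi> \<inter> {..<b})) =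
    of_nat (fact (n - b)) * block_poly q (b - 1)"
proof -
  let ?X = "{\<rho>. \<rho> permutes {b+1..n}}"
  note bij = bij_betw_prefix_block_perms[OF assms]
  have restrict: "block_tops n (\<sigma> \<circ> \<rho> \<circ> block_to_front s b) \<inter> {..<b} = block_tops (b - 1) \<sigma>"
    if *: "\<sigma> \<in> perms (b - 1)" "\<rho> \<in> ?X" for \<sigma> \<rho>
  proof -
    let ?\<pi> = "\<sigma> \<circ> \<rho> \<circ> block_to_front s b"
    have "?\<pi> \<in> {\<pi> \<in> perms n. prefix_block \<pi> s b}"
      using bij_betwE[OF bij] * by auto
    moreover have "?\<pi> (s + i) = \<sigma> i" if "i \<in> {1..b-1}" for i
      using that * permutes_not_in[of \<rho> "{b+1..n}" i] by (auto simp: block_to_front_def)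
    ultimately show ?thesis
      using assms by (intro block_tops_below) (auto simp: perms_def intro: permutes_inj)
  qed
  have "(\<Sum>\<pi> | \<pi> \<in> perms n \<and> prefix_block \<pi> s b. q ^ card (block_tops n \<pi> \<inter> {..<b})) =
    (\<Sum>(\<sigma>, \<rho>)\<in>perms (b - 1) \<times> ?X. q ^ card (block_tops (b - 1) \<sigma>))"
    by (subst sum.reindex_bij_betw[OF bij, symmetric]) (auto intro!: sum.cong simp: restrict)
  also have "\<dots> = (\<Sum>\<sigma>\<in>perms (b - 1). of_nat (card ?X) * q ^ card (block_tops (b - 1) \<sigma>))"
    by (simp add: sum.cartesian_product[symmetric])
  also have "card ?X = fact (n - b)"
    by (subst card_permutations[of "{b+1..n}" "n - b"]) auto
  finally show ?thesis by (simp add: block_poly_def sum_distrib_left)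
qed

text \<open>A permutation has at most one block with top \<open>b\<close>, so the \<open>n - b + 1\<close> possible starting places
  give disjoint classes, each contributing \<open>(n - b)!\<close> times the distribution of the inner part.\<close>

lemma sum_block_top:
  fixes q :: "'a::comm_ring_1"
  assumes "2 \<le> b" "b \<le> n"
  shows "(\<Sum>\<pi> | \<pi> \<in> perms n \<and> b \<in> block_tops n \<pi>. q ^ card (block_tops n \<pi> \<inter> {..<b})) =
    of_nat (fact (n - b + 1)) * block_poly q (b - 1)"
proof -
  let ?B = "\<lambda>s. {\<pi> \<in> perms n. prefix_block \<pi> s b}"
  have "{\<pi>. \<pi> \<in> perms n \<and> b \<in> block_tops n \<pi>} = (\<Union>s\<in>{..n-b}. ?B s)"
    using assms by (auto simp: block_tops_def le_diff_conv2)
  moreover have "?B s \<inter> ?B s' = {}" if "s \<noteq> s'" for s s'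
  proof -
    have "s = s'" if "\<pi> \<in> ?B s" "\<pi> \<in> ?B s'" for \<pi>
    proof -
      have "\<pi> (s + b) = \<pi> (s' + b)" using that by (simp add: prefix_block_def)
      moreover have "inj \<pi>" using that by (auto simp: perms_def intro: permutes_inj)
      ultimately have "s + b = s' + b" by (simp only: inj_eq)
      then show ?thesis by simp
    qed
    then show ?thesis using \<open>s \<noteq> s'\<close> by blast
  qed
  ultimately have "(\<Sum>\<pi> | \<pi> \<in> perms n \<and> b \<in> block_tops n \<pi>. q ^ card (block_tops n \<pi> \<inter> {..<b})) =
    (\<Sum>s\<le>n-b. \<Sum>\<pi>\<in>?B s. q ^ card (block_tops n \<pi> \<inter> {..<b}))"
    by (simp only:) (intro sum.UNION_disjoint, auto)
  also have "\<dots> = (\<Sum>s\<le>n-b. of_nat (fact (n - b)) * block_poly q (b - 1))"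
    using assms by (intro sum.cong sum_fixed_block) auto
  also have "\<dots> = of_nat (fact (n - b + 1)) * block_poly q (b - 1)"
    by (simp add: distrib_right mult.assoc)
  finally show ?thesis .
qed

text \<open>Listing \<open>S\<close> in increasing order, the \<open>j\<close>-th summand is \<open>q ^ j\<close> (counting from 0): this is the
  geometric sum, indexed by the set itself.\<close>

lemma power_card_telescope:
  fixes q :: "'a::comm_ring_1" and S :: "'b::linorder set"
  assumes "finite S"
  shows "q ^ card S = 1 + (q - 1) * (\<Sum>b\<in>S. q ^ card (S \<inter> {..<b}))"
  using assms
proof (induction S rule: finite_linorder_max_induct)
  case (insert b S)
  let ?T = "\<Sum>c\<in>S. q ^ card (S \<inter> {..<c})"
  have "b \<notin> S" using insert by auto
  have below_b: "insert b S \<inter> {..<b} = S" using insert by auto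
  have below_others: "(\<Sum>c\<in>S. q ^ card (insert b S \<inter> {..<c})) = ?T"
  proof (intro sum.cong refl)
    fix c assume "c \<in> S"
    then have "insert b S \<inter> {..<c} = S \<inter> {..<c}" using insert by auto
    then show "q ^ card (insert b S \<inter> {..<c}) = q ^ card (S \<inter> {..<c})" by simp
  qed
  have "q ^ card (insert b S) = q ^ card S + (q - 1) * q ^ card S"
    using insert \<open>b \<notin> S\<close> by (simp add: algebra_simps)
  also have "\<dots> = 1 + (q - 1) * (q ^ card S + ?T)"
    using insert.IH by (simp add: distrib_left)
  also have "q ^ card S + ?T = (\<Sum>c\<in>insert b S. q ^ card (insert b S \<inter> {..<c}))"
    using insert \<open>b \<notin> S\<close> by (simp add: below_b below_others)
  finally show ?case .
qed simp

text \<open>Apply the telescoping to the set of tops of each permutation and exchange the two sums.\<close>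

lemma block_poly_rec:
  fixes q :: "'a::comm_ring_1"
  shows "block_poly q n =
    of_nat (fact n) + (q - 1) * (\<Sum>b=2..n. block_poly q (b - 1) * of_nat (fact (n - b + 1)))"
proof -
  let ?w = "\<lambda>\<pi> b. q ^ card (block_tops n \<pi> \<inter> {..<b})"
  have "block_poly q n = (\<Sum>\<pi>\<in>perms n. 1 + (q - 1) * (\<Sum>b\<in>block_tops n \<pi>. ?w \<pi> b))"
    unfolding block_poly_def by (intro sum.cong refl power_card_telescope) simp
  also have "\<dots> = of_nat (fact n) + (q - 1) * (\<Sum>\<pi>\<in>perms n. \<Sum>b\<in>block_tops n \<pi>. ?w \<pi> b)"
    by (simp add: sum.distrib sum_distrib_left card_perms)
  also have "(\<Sum>\<pi>\<in>perms n. \<Sum>b\<in>block_tops n \<pi>. ?w \<pi> b) =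
      (\<Sum>\<pi>\<in>perms n. \<Sum>b | b \<in> {2..n} \<and> b \<in> block_tops n \<pi>. ?w \<pi> b)"
    by (intro sum.cong) (auto simp: block_tops_def)
  also have "\<dots> = (\<Sum>b=2..n. \<Sum>\<pi> | \<pi> \<in> perms n \<and> b \<in> block_tops n \<pi>. ?w \<pi> b)"
    by (rule sum.swap_restrict) auto
  also have "\<dots> = (\<Sum>b=2..n. block_poly q (b - 1) * of_nat (fact (n - b + 1)))"
    by (intro sum.cong refl) (subst sum_block_top, auto)
  finally show ?thesis .
qed

unbundle fps_syntax

section \<open>The generating functions\<close>

text \<open>Subtracting 1 from both series removes the constant terms, so the convolution runs over
  \<open>1 \<le> i \<le> n - 1\<close>; this is the range of the recurrence under \<open>i = b - 1\<close>.\<close>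

lemma distribution_fps_functional_equation:
  fixes q :: "'a::comm_ring_1"
  defines "W \<equiv> distribution_fps {(0, 0), (0, 1), (1, 2), (2, 0), (2, 1)} q"
  shows "W - 1 = (fact_fps - 1) + fps_const (q - 1) * ((W - 1) * (fact_fps - 1))"
proof (rule fps_ext)
  fix n
  have W: "W $ k = block_poly q k" for k
    unfolding W_def distribution_fps_def block_poly_def fps_nth_Abs_fps
    by (intro sum.cong refl) (simp only: mesh12_count_eq_card_block_tops)
  have W0: "block_poly q 0 = 1" using block_poly_rec[of q 0] by simp
  show "(W - 1) $ n = (fact_fps - 1 + fps_const (q - 1) * ((W - 1) * (fact_fps - 1))) $ n"
  proof (cases "n = 0")
    case True
    then show ?thesis by (simp add: W W0 fact_fps_def)
  next
    case False
    have "((W - 1) * (fact_fps - 1)) $ n =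
        (\<Sum>i=0..n. (W - 1) $ i * (fact_fps - 1) $ (n - i))"
      by (rule fps_mult_nth)
    also have "\<dots> = (\<Sum>i=1..n-1. block_poly q i * of_nat (fact (n - i)))"
      by (intro sum.mono_neutral_cong_right) (auto simp: W W0 fact_fps_def)
    also have "\<dots> = (\<Sum>b=2..n. block_poly q (b - 1) * of_nat (fact (n - b + 1)))"
      by (rule sum.reindex_bij_witness[of _ "\<lambda>b. b - 1" Suc])
        (auto simp: Suc_diff_Suc simp del: fact_Suc)
    finally have "((W - 1) * (fact_fps - 1)) $ n =
        (\<Sum>b=2..n. block_poly q (b - 1) * of_nat (fact (n - b + 1)))" .
    then show ?thesis using False block_poly_rec[of q n] by (simp add: W fact_fps_def)
  qed
qed

text \<open>The equation solved for the series, with the denominator multiplied out: in this form it holds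
  over every commutative ring, so it can be used both at \<open>q = 0\<close> and at the indeterminate.\<close>

lemma distribution_fps_mult:
  fixes q :: "'a::comm_ring_1"
  shows "distribution_fps {(0, 0), (0, 1), (1, 2), (2, 0), (2, 1)} q *
      (fps_const (1 - q) * fact_fps + fps_const q) =
    fps_const (2 - q) * fact_fps + fps_const q - 1"
proof -
  define c where "c = fps_const q"
  have constants: "fps_const (1 - q) = 1 - c" "fps_const (2 - q) = 2 - c" "fps_const (q - 1) = c - 1"
    by (simp_all add: c_def flip: fps_const_sub add: fps_numeral_fps_const)
  define F :: "'a fps" where "F = fact_fps"
  define W where "W = distribution_fps {(0, 0), (0, 1), (1, 2), (2, 0), (2, 1)} q"
  have eq: "W - 1 = (F - 1) + (c - 1) * ((W - 1) * (F - 1))"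
    using distribution_fps_functional_equation[of q] by (simp add: W_def F_def constants)
  \<comment> \<open>The two equations differ only by rearrangement: their defects are equal.\<close>
  have "W * ((1 - c) * F + c) - ((2 - c) * F + c - 1) =
      (W - 1) - ((F - 1) + (c - 1) * ((W - 1) * (F - 1)))"
    by (simp add: algebra_simps)
  then have "W * ((1 - c) * F + c) = (2 - c) * F + c - 1"
    using eq by simp
  then show ?thesis by (simp add: W_def F_def constants flip: c_def)
qed

text \<open>Only avoiders survive at \<open>q = 0\<close>, since \<open>0 ^ 0 = 1\<close>.\<close>

lemma avoidance_fps_eq_distribution_fps_0:
  "avoidance_fps R = distribution_fps R (0 :: 'a::comm_ring_1)"
proof (rule fps_ext)
  fix n
  have "(\<Sum>\<pi>\<in>perms n. (0 :: 'a) ^ mesh12_count R n \<pi>) =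
      (\<Sum>\<pi>\<in>perms n. if mesh12_count R n \<pi> = 0 then 1 else 0)"
    by (intro sum.cong) (auto simp: power_0_left)
  also have "\<dots> = of_nat (card (mesh12_avoiders R n))"
    by (simp add: mesh12_avoiders_def sum.If_cases Int_def)
  finally show "avoidance_fps R $ n = distribution_fps R (0 :: 'a) $ n"
    by (simp add: avoidance_fps_def distribution_fps_def)
qed

theorem theorem3p10:
  fixes R :: "(nat \<times> nat) set"
  defines "R \<equiv> {(0, 0), (0, 1), (1, 2), (2, 0), (2, 1)}"
  shows "(avoidance_fps R :: rat fps) = (2 * fact_fps - 1) / fact_fps \<and>
    distribution_fps R qvar =
      (fps_const (2 - qvar) * fact_fps + fps_const qvar - 1) /
      (fps_const (1 - qvar) * fact_fps + fps_const qvar)"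
proof -
  \<comment> \<open>Both denominators have constant term 1, so they are nonzero and cancel.\<close>
  have divide: "f = g / h" if "f * h = g" "h $ 0 = 1" for f g h :: "'b::field fps"
    using that by (auto intro!: nonzero_mult_div_cancel_right[symmetric])
  have "avoidance_fps R * fact_fps = (2 * fact_fps - 1 :: rat fps)"
    using distribution_fps_mult[of "0 :: rat"]
    by (simp add: R_def avoidance_fps_eq_distribution_fps_0 flip: fps_numeral_fps_const)
  moreover have "distribution_fps R qvar * (fps_const (1 - qvar) * fact_fps + fps_const qvar) =
      fps_const (2 - qvar) * fact_fps + fps_const qvar - 1"
    unfolding R_def by (rule distribution_fps_mult)
  ultimately show ?thesis by (intro conjI divide) (simp_all add: fact_fps_def)
qed

end
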